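(* Let $p$ be an odd prime, let $\alpha\in[0,1]$, and let $G=D_p\times D_p$, a group of order $4p^2$. Then the spectrum of $A_\alpha(\mathcal{S}_{D_p\times D_p})$, as a multiset of $4p^2$ eigenvalues, consists of: (i) $(3p^2-2p)\alpha-1$, taken $p^2-2$ times; (ii) $4p^2\alpha-1$, taken $2p^2-2p-1$ times; (iii) $(3p^2+1)\alpha-1$, taken $p^2+2p-1$ times; (iv) the remaining $4$ eigenvalues, which are the roots $\lambda$ (with multiplicity) of the equation $\det(M-\lambda I_4)=0$, where $M$ is the $4\times 4$ matrix $$M=\begin{pmatrix} (4p^2-1)\alpha & (p^2+2p)(1-\alpha) & (2p^2-2p)(1-\alpha) & (p^2-1)(1-\alpha)\\ 1-\alpha & (p^2+2p-1)(1-\alpha)+3p^2\alpha & (2p^2-2p)(1-\alpha) & 0\\ 1-\alpha & (p^2+2p)(1-\alpha) & (2p^2-2p-1)(1-\alpha)+(4p^2-1)\alpha & (p^2-1)(1-\alpha)\\ 1-\alpha & 0 & (2p^2-2p)(1-\alpha) & (p^2-2)+(2p^2-2p+1)\alpha \end{pmatrix}.$$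
   Context: $D_n$ denotes the dihedral group of order $2n$, generated by $a,b$ with $o(a)=n$, $o(b)=2$, $ba=a^{-1}b$; $o(x)$ is the order of a group element $x$. For a finite group $G$, the superpower graph $\mathcal{S}_G$ is the simple undirected graph whose vertex set is $G$, with two distinct vertices $x,y$ adjacent if and only if $o(x)\mid o(y)$ or $o(y)\mid o(x)$. For a graph $\Gamma$ with adjacency matrix $A(\Gamma)$ and diagonal matrix of vertex degrees $D(\Gamma)$, and $\alpha\in[0,1]$, the $A_\alpha$-adjacency matrix is $A_\alpha(\Gamma)=\alpha D(\Gamma)+(1-\alpha)A(\Gamma)$. Its spectrum is the multiset of its eigenvalues counted with multiplicity; listed values may coincide for particular $p,\alpha$, in which case multiplicities add. *)

theory Defs
  imports
    "HOL-Algebra.Multiplicative_Group"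
    "HOL-Algebra.Generated_Groups"
    "HOL-Computational_Algebra.Fundamental_Theorem_Algebra"
    "Jordan_Normal_Form.Char_Poly"
    "Graph_Theory.Pair_Digraph"
begin

section \<open>Dihedral groups\<close>

definition is_dihedral :: "nat \<Rightarrow> ('a, 'b) monoid_scheme \<Rightarrow> bool" where
  "is_dihedral n D \<longleftrightarrow>
     group D \<and> card (carrier D) = 2 * n \<and>
     (\<exists>a\<in>carrier D. \<exists>b\<in>carrier D.
        generate D {a, b} = carrier D \<and>
        group.ord D a = n \<and> group.ord D b = 2 \<and>
        b \<otimes>\<^bsub>D\<^esub> a = inv\<^bsub>D\<^esub> a \<otimes>\<^bsub>D\<^esub> b)"

text \<open>
  The predicate is satisfiable: \<open>(i, s)\<close> stands for \<open>a\<^sup>i b\<^sup>s\<close>.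
\<close>

definition dihedral_model :: "nat \<Rightarrow> (int \<times> bool) monoid" where
  "dihedral_model n =
     \<lparr> carrier = {0..<int n} \<times> UNIV,
       monoid.mult = (\<lambda>(i, s) (j, t). ((if s then i - j else i + j) mod int n, s \<noteq> t)),
       monoid.one = (0, False) \<rparr>"

lemma is_dihedral_dihedral_model:
  assumes n: "n > 0"
  shows "is_dihedral n (dihedral_model n)"
proof -
  let ?D = "dihedral_model n"
  let ?a = "(1 mod int n, False)" and ?b = "(0 :: int, True)"
  have grp: "group ?D"
  proof (rule groupI)
    fix x assume "x \<in> carrier ?D"
    then obtain i s where x: "x = (i, s)" "0 \<le> i" "i < int n"
      by (auto simp: dihedral_model_def)
    let ?y = "(if s then i else (- i) mod int n, s)"
    have "?y \<in> carrier ?D" "?y \<otimes>\<^bsub>?D\<^esub> x = \<one>\<^bsub>?D\<^esub>"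
      using x n by (auto simp: dihedral_model_def mod_simps)
    thus "\<exists>y\<in>carrier ?D. y \<otimes>\<^bsub>?D\<^esub> x = \<one>\<^bsub>?D\<^esub>" by blast
  qed (use n in \<open>auto simp: dihedral_model_def mod_simps algebra_simps\<close>)
  interpret group ?D by (rule grp)
  have a: "?a \<in> carrier ?D" and b: "?b \<in> carrier ?D"
    using n by (auto simp: dihedral_model_def)
  have apow: "?a [^]\<^bsub>?D\<^esub> k = (int k mod int n, False)" for k :: nat
    by (induction k) (auto simp: dihedral_model_def nat_pow_def mod_simps algebra_simps)
  have bpow: "?b [^]\<^bsub>?D\<^esub> k = (0, odd k)" for k :: nat
    by (induction k) (auto simp: dihedral_model_def nat_pow_def)
  have one: "\<one>\<^bsub>?D\<^esub> = (0, False)" by (simp add: dihedral_model_def)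
  have orda: "ord ?a = n"
    unfolding ord_unique[OF a] by (auto simp: apow one mod_eq_0_iff_dvd)
  have ordb: "ord ?b = 2"
    unfolding ord_unique[OF b] by (auto simp: bpow one)
  have inva: "inv\<^bsub>?D\<^esub> ?a = ((-1) mod int n, False)"
    by (rule inv_equality) (use a n in \<open>auto simp: dihedral_model_def mod_simps\<close>)
  have rel: "?b \<otimes>\<^bsub>?D\<^esub> ?a = inv\<^bsub>?D\<^esub> ?a \<otimes>\<^bsub>?D\<^esub> ?b"
    unfolding inva by (auto simp: dihedral_model_def mod_simps)
  have agen: "?a [^]\<^bsub>?D\<^esub> k \<in> generate ?D {?a, ?b}" for k :: nat
    by (induction k) (auto intro: generate.intros)
  have "carrier ?D \<subseteq> generate ?D {?a, ?b}"
  proof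
    fix x assume "x \<in> carrier ?D"
    then obtain i s where x: "x = (i, s)" "0 \<le> i" "i < int n"
      by (auto simp: dihedral_model_def)
    have ai: "?a [^]\<^bsub>?D\<^esub> nat i = (i, False)" using x by (simp add: apow)
    have "?a [^]\<^bsub>?D\<^esub> nat i \<otimes>\<^bsub>?D\<^esub> ?b = (i, True)"
      unfolding ai using x by (simp add: dihedral_model_def)
    moreover have "?a [^]\<^bsub>?D\<^esub> nat i \<otimes>\<^bsub>?D\<^esub> ?b \<in> generate ?D {?a, ?b}"
      by (intro generate.eng agen generate.incl) simp
    ultimately show "x \<in> generate ?D {?a, ?b}"
      using agen[of "nat i"] ai x by (cases s) auto
  qed
  moreover have "generate ?D {?a, ?b} \<subseteq> carrier ?D"
    by (rule generate_incl) (use a b in auto)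
  ultimately have gen: "generate ?D {?a, ?b} = carrier ?D" by blast
  have "card (carrier ?D) = 2 * n"
    by (simp add: dihedral_model_def card_cartesian_product)
  with grp a b gen orda ordb rel show ?thesis
    unfolding is_dihedral_def by blast
qed

section \<open>The superpower graph\<close>

text \<open>
  A simple undirected graph is a finite, loop-free, symmetric \<open>pair_pre_digraph\<close>
  (locale \<open>pair_graph\<close>): an edge \<open>{x, y}\<close> is the pair of arcs \<open>(x, y)\<close>, \<open>(y, x)\<close>.
\<close>

definition superpower_graph :: "('a, 'b) monoid_scheme \<Rightarrow> 'a pair_pre_digraph" where
  "superpower_graph G =
     \<lparr> pverts = carrier G,
       parcs = {(x, y). x \<in> carrier G \<and> y \<in> carrier G \<and> x \<noteq> y \<and>
                  (group.ord G x dvd group.ord G y \<or> group.ord G y dvd group.ord G x)} \<rparr>"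

lemma pair_graph_superpower_graph:
  assumes "finite (carrier G)"
  shows "pair_graph (superpower_graph G)"
proof -
  have "parcs (superpower_graph G) \<subseteq> carrier G \<times> carrier G"
    by (auto simp: superpower_graph_def)
  then have "finite (parcs (superpower_graph G))"
    using assms by (meson finite_SigmaI finite_subset)
  then show ?thesis
    using assms
    by unfold_locales (auto simp: superpower_graph_def symmetric_def intro!: symI)
qed

section \<open>Matrices of a graph\<close>

text \<open>
  Matrices are indexed by natural numbers, so a graph is given together with a list \<open>vs\<close>
  enumerating its vertices without repetition.
\<close>

definition adjacency_matrix :: "'a pair_pre_digraph \<Rightarrow> 'a list \<Rightarrow> real mat" where
  "adjacency_matrix \<Gamma> vs =
     mat (length vs) (length vs)
       (\<lambda>(i, j). if (vs ! i, vs ! j) \<in> parcs \<Gamma> then 1 else 0)"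

text \<open>In a symmetric digraph the out-degree is the degree of the undirected graph.\<close>

definition degree_matrix :: "'a pair_pre_digraph \<Rightarrow> 'a list \<Rightarrow> real mat" where
  "degree_matrix \<Gamma> vs =
     mat (length vs) (length vs)
       (\<lambda>(i, j). if i = j then real (out_degree (with_proj \<Gamma>) (vs ! i)) else 0)"

definition A_alpha_matrix :: "real \<Rightarrow> 'a pair_pre_digraph \<Rightarrow> 'a list \<Rightarrow> real mat" where
  "A_alpha_matrix \<alpha> \<Gamma> vs =
     \<alpha> \<cdot>\<^sub>m degree_matrix \<Gamma> vs + (1 - \<alpha>) \<cdot>\<^sub>m adjacency_matrix \<Gamma> vs"

text \<open>
  Eigenvalues are counted with algebraic multiplicity over the complex numbers, so that an
  \<open>n \<times> n\<close> matrix always has exactly \<open>n\<close> of them.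
\<close>

definition eigenvalue_mset :: "real mat \<Rightarrow> complex multiset" where
  "eigenvalue_mset A = proots (char_poly (map_mat complex_of_real A))"

lemma size_eigenvalue_mset:
  "A \<in> carrier_mat n n \<Longrightarrow> size (eigenvalue_mset A) = n"
  unfolding eigenvalue_mset_def size_proots_complex
  using degree_monic_char_poly[of "map_mat complex_of_real A" n] by simp

section \<open>The four-by-four matrix\<close>

definition M_matrix :: "nat \<Rightarrow> real \<Rightarrow> real mat" where
  "M_matrix n \<alpha> = (let p = real n in mat_of_rows_list 4
     [[(4*p^2 - 1)*\<alpha>, (p^2 + 2*p)*(1 - \<alpha>), (2*p^2 - 2*p)*(1 - \<alpha>), (p^2 - 1)*(1 - \<alpha>)],
      [1 - \<alpha>, (p^2 + 2*p - 1)*(1 - \<alpha>) + 3*p^2*\<alpha>, (2*p^2 - 2*p)*(1 - \<alpha>), 0],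
      [1 - \<alpha>, (p^2 + 2*p)*(1 - \<alpha>), (2*p^2 - 2*p - 1)*(1 - \<alpha>) + (4*p^2 - 1)*\<alpha>, (p^2 - 1)*(1 - \<alpha>)],
      [1 - \<alpha>, 0, (2*p^2 - 2*p)*(1 - \<alpha>), (p^2 - 2) + (2*p^2 - 2*p + 1)*\<alpha>]])"

text \<open>The polynomial \<open>det (M - \<lambda> I)\<close> in the indeterminate \<open>\<lambda> = [:0, 1:]\<close>, over the complex numbers.\<close>

definition M_det_poly :: "nat \<Rightarrow> real \<Rightarrow> complex poly" where
  "M_det_poly n \<alpha> =
     det (map_mat (\<lambda>x. [:complex_of_real x:]) (M_matrix n \<alpha>) - [:0, 1:] \<cdot>\<^sub>m 1\<^sub>m 4)"

end

theory Submission
  imports Defs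
begin

text \<open>
  Adjacency in the superpower graph depends only on the orders of the two vertices, and the orders
  in \<open>D\<^sub>p \<times> D\<^sub>p\<close> are 1, 2, \<open>2p\<close> and \<open>p\<close>. Hence \<open>A\<^sub>\<alpha>\<close> is \<open>E + P W P\<^sup>T\<close>, where \<open>P\<close> is the indicator
  matrix of the four order classes and \<open>E\<close> is diagonal with entry \<open>d\<^sub>k\<close> on class \<open>k\<close>. By
  \<open>det (1 - A B) = det (1 - B A)\<close>, its characteristic polynomial is that of the \<open>4 \<times> 4\<close> quotient
  matrix times the product of \<open>(x - d\<^sub>k)\<^bsup>n\<^sub>k - 1\<^esup>\<close>, \<open>n\<^sub>k\<close> being the class sizes. The identity forms a
  class of size 1 and contributes no such factor.
\<close>

section \<open>Characteristic polynomials of matrices that are constant on blocks up to the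
  diagonal\<close>

text \<open>The block matrix with rows \<open>(1, A)\<close> and \<open>(B, 1)\<close> factors in
  two ways through the unit lower triangular \<open>?L\<close>. One cofactor carries the Schur
  complement \<open>1 - A * B\<close>, the other \<open>1 - B * A\<close>, and \<open>?L\<close> has
  determinant 1.\<close>

lemma det_one_minus_mult_commute:
  fixes A B :: "'a :: idom mat"
  assumes A: "A \<in> carrier_mat n m" and B: "B \<in> carrier_mat m n"
  shows "det (1\<^sub>m n - A * B) = det (1\<^sub>m m - B * A)"
proof -
  let ?L = "four_block_mat (1\<^sub>m n) (0\<^sub>m n m) B (1\<^sub>m m)"
  have AB: "1\<^sub>m n - A * B \<in> carrier_mat n n" and BA: "1\<^sub>m m - B * A \<in> carrier_mat m m"
    using A B by auto
  have L: "?L \<in> carrier_mat (n + m) (n + m)" by simp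
  have eqs: "1\<^sub>m n - A * B + A * B = 1\<^sub>m n" "B * A + (1\<^sub>m m - B * A) = 1\<^sub>m m"
    by (rule eq_matI, use A B in auto)+
  have L1: "?L * four_block_mat (1\<^sub>m n) A (0\<^sub>m m n) (1\<^sub>m m - B * A) =
      four_block_mat (1\<^sub>m n) A B (1\<^sub>m m)"
    by (subst mult_four_block_mat[of _ n n _ m _ m _ _ n _ m], use A B eqs in auto)
  have L2: "four_block_mat (1\<^sub>m n - A * B) A (0\<^sub>m m n) (1\<^sub>m m) * ?L =
      four_block_mat (1\<^sub>m n) A B (1\<^sub>m m)"
    by (subst mult_four_block_mat[of _ n n _ m _ m _ _ n _ m], use A B eqs in auto)
  have detL: "det ?L = 1"
    by (subst det_four_block_mat_upper_right_zero[of _ n _ m]) (use B in auto)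
  have "det (1\<^sub>m n - A * B) =
      det (four_block_mat (1\<^sub>m n - A * B) A (0\<^sub>m m n) (1\<^sub>m m)) * det ?L"
    unfolding detL by (subst det_four_block_mat_lower_left_zero[of _ n _ m]) (use A B in auto)
  also have "\<dots> = det (four_block_mat (1\<^sub>m n) A B (1\<^sub>m m))"
    by (subst det_mult[of _ "n + m", symmetric]) (use AB L2 in auto)
  also have "\<dots> = det ?L * det (four_block_mat (1\<^sub>m n) A (0\<^sub>m m n) (1\<^sub>m m - B * A))"
    by (subst det_mult[of _ "n + m", symmetric]) (use BA L1 in auto)
  also have "\<dots> = det (1\<^sub>m m - B * A)"
    unfolding detL by (subst det_four_block_mat_lower_left_zero[of _ n _ m]) (use A B in auto)
  finally show ?thesis .
qed

lemma det_diagonal_mat: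
  fixes f :: "nat \<Rightarrow> 'a :: comm_ring_1"
  shows "det (mat n n (\<lambda>(i, j). if i = j then f i else 0)) = (\<Prod>i<n. f i)"
  by (subst det_upper_triangular[of _ n])
     (auto simp: upper_triangular_def prod_list_diag_prod atLeast0LessThan)

text \<open>
  Both sides carry the extra factor \<open>\<Prod>k<m. (x - d k)\<close> so that empty classes are allowed. Away from
  the values \<open>d k\<close> the diagonal part of \<open>x - A\<close> is invertible, which reduces \<open>det (x - A)\<close> to a
  determinant of size \<open>m\<close>; polynomials that agree at infinitely many points are equal.
\<close>

lemma char_poly_blockwise_constant:
  fixes d :: "nat \<Rightarrow> 'a :: field_char_0" and w :: "nat \<Rightarrow> nat \<Rightarrow> 'a" and c :: "nat \<Rightarrow> nat"
  assumes c: "\<And>i. i < n \<Longrightarrow> c i < m"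
  defines "A \<equiv> mat n n (\<lambda>(i, j). (if i = j then d (c i) else 0) + w (c i) (c j))"
    and "s \<equiv> \<lambda>k. card {i. i < n \<and> c i = k}"
  defines "Q \<equiv> mat m m (\<lambda>(k, l). (if k = l then d k else 0) + w k l * of_nat (s l))"
  shows "char_poly A * (\<Prod>k<m. [:- d k, 1:]) = char_poly Q * (\<Prod>k<m. [:- d k, 1:] ^ s k)"
    (is "?p = ?q")
proof -
  have eval: "poly ?p x = poly ?q x" if x: "x \<notin> d ` {..<m}" for x
  proof -
    have nz: "x - d k \<noteq> 0" if "k < m" for k using x that by auto
    let ?E = "mat n n (\<lambda>(i, j). if i = j then x - d (c i) else 0)"
    let ?F = "mat m m (\<lambda>(k, l). if k = l then x - d k else 0)"
    \<comment> \<open>\<open>U\<close> is the class indicator matrix with the inverse of the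
      diagonal part absorbed. Thus \<open>?E * (1 - U * V)\<close> is \<open>x - A\<close>, while
      the reversed product gives \<open>(1 - V * U) * ?F\<close>, which is \<open>x - Q\<close>; the
      column sums in \<open>V * U\<close> produce the class sizes.\<close>
    define U where "U = mat n m (\<lambda>(i, k). if c i = k then 1 / (x - d k) else 0)"
    define V where "V = mat m n (\<lambda>(k, j). w k (c j))"
    have U: "U \<in> carrier_mat n m" and V: "V \<in> carrier_mat m n"
      by (auto simp: U_def V_def)
    have UV: "(U * V) $$ (i, j) = w (c i) (c j) / (x - d (c i))" if "i < n" "j < n" for i j
    proof -
      have "(U * V) $$ (i, j) =
          (\<Sum>k = 0..<m. (if c i = k then 1 / (x - d k) else 0) * w k (c j))"
        using that by (simp add: U_def V_def scalar_prod_def)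
      also have "\<dots> = (\<Sum>k = 0..<m. if k = c i then w (c i) (c j) / (x - d (c i)) else 0)"
        by (intro sum.cong) auto
      finally show ?thesis using c that by simp
    qed
    have VU: "(V * U) $$ (k, l) = w k l * of_nat (s l) / (x - d l)" if "k < m" "l < m" for k l
    proof -
      have "(V * U) $$ (k, l) =
          (\<Sum>j = 0..<n. w k (c j) * (if c j = l then 1 / (x - d l) else 0))"
        using that by (simp add: U_def V_def scalar_prod_def)
      also have "\<dots> = (\<Sum>j = 0..<n. if c j = l then w k l / (x - d l) else 0)"
        by (intro sum.cong) auto
      also have "\<dots> = (\<Sum>j \<in> {j. j < n \<and> c j = l}. w k l / (x - d l))"
        by (subst sum.inter_filter[symmetric]) (auto intro!: sum.cong)
      finally show ?thesis by (simp add: s_def)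
    qed
    have "poly (char_poly A) x = det (?E * (1\<^sub>m n - U * V))"
      unfolding char_poly_def
    proof (rule poly_det_cong)
      fix i j assume ij: "i < n" "j < n"
      have "(?E * (1\<^sub>m n - U * V)) $$ (i, j) =
          (\<Sum>k = 0..<n. (if i = k then x - d (c i) else 0) * (1\<^sub>m n - U * V) $$ (k, j))"
        using ij U V by (simp add: scalar_prod_def)
      also have "\<dots> = (\<Sum>k = 0..<n. if k = i then (x - d (c i)) * (1\<^sub>m n - U * V) $$ (i, j) else 0)"
        by (intro sum.cong) auto
      also have "\<dots> = (x - d (c i)) * (1\<^sub>m n - U * V) $$ (i, j)"
        using ij by simp
      also have "\<dots> = (x - d (c i)) * ((if i = j then 1 else 0) - w (c i) (c j) / (x - d (c i)))"
        using ij U V UV by simp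
      also have "\<dots> = poly (char_poly_matrix A $$ (i, j)) x"
        using ij nz[OF c[OF ij(1)]] by (simp add: char_poly_matrix_def A_def field_simps)
      finally show "poly (char_poly_matrix A $$ (i, j)) x = (?E * (1\<^sub>m n - U * V)) $$ (i, j)" ..
    qed (use U V in \<open>auto simp: A_def\<close>)
    also have "\<dots> = (\<Prod>i<n. x - d (c i)) * det (1\<^sub>m n - U * V)"
      by (subst det_mult[of _ n]) (use U V in \<open>auto simp: det_diagonal_mat\<close>)
    also have "(\<Prod>i<n. x - d (c i)) = (\<Prod>k<m. \<Prod>i \<in> {i \<in> {..<n}. c i = k}. x - d (c i))"
      by (rule prod.group[symmetric]) (use c in auto)
    also have "\<dots> = (\<Prod>k<m. (x - d k) ^ s k)"
      by (intro prod.cong) (auto simp: s_def)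
    also have "det (1\<^sub>m n - U * V) = det (1\<^sub>m m - V * U)"
      by (rule det_one_minus_mult_commute[OF U V])
    finally have A: "poly (char_poly A) x = (\<Prod>k<m. (x - d k) ^ s k) * det (1\<^sub>m m - V * U)" .
    have "poly (char_poly Q) x = det ((1\<^sub>m m - V * U) * ?F)"
      unfolding char_poly_def
    proof (rule poly_det_cong)
      fix k l assume kl: "k < m" "l < m"
      have "((1\<^sub>m m - V * U) * ?F) $$ (k, l) =
          (\<Sum>j = 0..<m. (1\<^sub>m m - V * U) $$ (k, j) * (if j = l then x - d j else 0))"
        using kl U V by (simp add: scalar_prod_def)
      also have "\<dots> = (\<Sum>j = 0..<m. if j = l then (1\<^sub>m m - V * U) $$ (k, l) * (x - d l) else 0)"
        by (intro sum.cong) auto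
      also have "\<dots> = (1\<^sub>m m - V * U) $$ (k, l) * (x - d l)"
        using kl by simp
      also have "\<dots> = ((if k = l then 1 else 0) - w k l * of_nat (s l) / (x - d l)) * (x - d l)"
        using kl U V VU by simp
      also have "\<dots> = poly (char_poly_matrix Q $$ (k, l)) x"
        using kl nz[OF kl(2)] by (simp add: char_poly_matrix_def Q_def field_simps)
      finally show "poly (char_poly_matrix Q $$ (k, l)) x = ((1\<^sub>m m - V * U) * ?F) $$ (k, l)" ..
    qed (use U V in \<open>auto simp: Q_def\<close>)
    also have "\<dots> = det (1\<^sub>m m - V * U) * (\<Prod>k<m. x - d k)"
      by (subst det_mult[of _ m]) (use U V in \<open>auto simp: det_diagonal_mat\<close>)
    finally show ?thesis
      using A by (simp add: poly_prod)
  qed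
  \<comment> \<open>The minus sign is set complement: removing finitely many points from a field of
    characteristic zero leaves an infinite set.\<close>
  have "\<not> finite (- d ` {..<m})"
    by (metis Compl_eq_Diff_UNIV Diff_infinite_finite finite_imageI finite_lessThan infinite_UNIV_char_0)
  moreover have "- d ` {..<m} \<subseteq> {x. poly (?p - ?q) x = 0}"
    using eval by auto
  ultimately have "?p - ?q = 0"
    using poly_roots_finite finite_subset by blast
  thus ?thesis by simp
qed

section \<open>Element orders in a dihedral group and in its square\<close>

lemma DirProd_pow:
  "(x, y) [^]\<^bsub>G \<times>\<times> H\<^esub> (n :: nat) = (x [^]\<^bsub>G\<^esub> n, y [^]\<^bsub>H\<^esub> n)"
  by (induction n) (simp_all add: nat_pow_def)

text \<open>Solution sets of \<open>z^n = 1\<close> are products over the two factors, whereas sets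
  of elements of exact order \<open>n\<close> are not. Orders are therefore counted through
  torsion.\<close>

lemma DirProd_torsion:
  "{z \<in> carrier (G \<times>\<times> H). z [^]\<^bsub>G \<times>\<times> H\<^esub> (n :: nat) = \<one>\<^bsub>G \<times>\<times> H\<^esub>} =
     {x \<in> carrier G. x [^]\<^bsub>G\<^esub> n = \<one>\<^bsub>G\<^esub>} \<times> {y \<in> carrier H. y [^]\<^bsub>H\<^esub> n = \<one>\<^bsub>H\<^esub>}"
  by (auto simp: DirProd_pow)

text \<open>The group splits into \<open>p\<close> rotations, all killed by \<open>p\<close>, and
  \<open>p\<close> reflections, all of order 2. As \<open>p\<close> is odd, the identity is the only
  element killed by both 2 and \<open>p\<close>.\<close>

lemma dihedral_torsion:
  assumes p: "prime p" "odd p" and D: "is_dihedral p D"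
  shows "card {x \<in> carrier D. x [^]\<^bsub>D\<^esub> (2 :: nat) = \<one>\<^bsub>D\<^esub>} = p + 1"
    and "card {x \<in> carrier D. x [^]\<^bsub>D\<^esub> p = \<one>\<^bsub>D\<^esub>} = p"
    and "{x \<in> carrier D. x [^]\<^bsub>D\<^esub> (2 * p) = \<one>\<^bsub>D\<^esub>} = carrier D"
proof -
  obtain a b where grp: "group D" and card: "card (carrier D) = 2 * p"
    and a: "a \<in> carrier D" and b: "b \<in> carrier D"
    and orda: "group.ord D a = p" and ordb: "group.ord D b = 2"
    and ba: "b \<otimes>\<^bsub>D\<^esub> a = inv\<^bsub>D\<^esub> a \<otimes>\<^bsub>D\<^esub> b"
    using D unfolding is_dihedral_def by blast
  interpret group D by fact
  have p0: "p > 1" using p prime_gt_1_nat by blast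
  have fin: "finite (carrier D)" using card p0 card_ge_0_finite[of "carrier D"] by simp
  define R where "R = (\<lambda>i. a [^]\<^bsub>D\<^esub> i) ` {..<p}"
  define S where "S = (\<lambda>x. x \<otimes>\<^bsub>D\<^esub> b) ` R"
  have R: "R \<subseteq> carrier D" and S: "S \<subseteq> carrier D"
    using a b by (auto simp: R_def S_def)
  have "{..<p} = {0..ord a - 1}" using orda p0 by auto
  hence cardR: "card R = p"
    unfolding R_def using ord_inj[OF a] p0 by (simp add: card_image orda)
  have R_pow: "x [^]\<^bsub>D\<^esub> p = \<one>\<^bsub>D\<^esub>" if "x \<in> R" for x
    using that a by (auto simp: R_def nat_pow_pow pow_eq_id orda)
  have bb: "b \<otimes>\<^bsub>D\<^esub> b = \<one>\<^bsub>D\<^esub>"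
    using pow_ord_eq_1[OF b] b by (simp add: ordb numeral_2_eq_2)
  \<comment> \<open>The defining relation, extended to powers of \<open>a\<close>, makes every
    \<open>a^i b\<close> square to the identity.\<close>
  have conj: "b \<otimes>\<^bsub>D\<^esub> a [^]\<^bsub>D\<^esub> (i :: nat) = inv\<^bsub>D\<^esub> (a [^]\<^bsub>D\<^esub> i) \<otimes>\<^bsub>D\<^esub> b" for i
  proof (induction i)
    case (Suc i)
    have "b \<otimes>\<^bsub>D\<^esub> a [^]\<^bsub>D\<^esub> Suc i = (b \<otimes>\<^bsub>D\<^esub> a [^]\<^bsub>D\<^esub> i) \<otimes>\<^bsub>D\<^esub> a"
      using a b by (simp add: m_assoc)
    also have "\<dots> = inv\<^bsub>D\<^esub> (a [^]\<^bsub>D\<^esub> i) \<otimes>\<^bsub>D\<^esub> (b \<otimes>\<^bsub>D\<^esub> a)"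
      using a b by (simp add: Suc.IH m_assoc)
    also have "\<dots> = (inv\<^bsub>D\<^esub> (a [^]\<^bsub>D\<^esub> i) \<otimes>\<^bsub>D\<^esub> inv\<^bsub>D\<^esub> a) \<otimes>\<^bsub>D\<^esub> b"
      using a b by (simp add: ba m_assoc)
    also have "inv\<^bsub>D\<^esub> (a [^]\<^bsub>D\<^esub> i) \<otimes>\<^bsub>D\<^esub> inv\<^bsub>D\<^esub> a = inv\<^bsub>D\<^esub> (a [^]\<^bsub>D\<^esub> Suc i)"
      using a by (metis inv_mult_group nat_pow_Suc2 nat_pow_closed)
    finally show ?case .
  qed (use b in simp)
  have S_ord: "ord x = 2" if xS: "x \<in> S" for x
  proof -
    obtain i :: nat where x: "x = a [^]\<^bsub>D\<^esub> i \<otimes>\<^bsub>D\<^esub> b"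
      using xS by (auto simp: S_def R_def)
    have xc: "x \<in> carrier D" using a b x by simp
    have "x \<otimes>\<^bsub>D\<^esub> x = a [^]\<^bsub>D\<^esub> i \<otimes>\<^bsub>D\<^esub> (b \<otimes>\<^bsub>D\<^esub> a [^]\<^bsub>D\<^esub> i) \<otimes>\<^bsub>D\<^esub> b"
      using a b by (simp add: x m_assoc)
    also have "\<dots> = (a [^]\<^bsub>D\<^esub> i \<otimes>\<^bsub>D\<^esub> inv\<^bsub>D\<^esub> (a [^]\<^bsub>D\<^esub> i)) \<otimes>\<^bsub>D\<^esub> (b \<otimes>\<^bsub>D\<^esub> b)"
      using a b by (simp add: conj m_assoc bb)
    also have "\<dots> = \<one>\<^bsub>D\<^esub>" using a bb by simp
    finally have "ord x dvd 2"
      using xc by (simp add: pow_eq_id[symmetric] numeral_2_eq_2)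
    \<comment> \<open>If \<open>a^i b\<close> were trivial, \<open>b\<close> would be the inverse of
      a power of \<open>a\<close>, so its order 2 would divide the odd number
      \<open>p\<close>.\<close>
    moreover have "ord x \<noteq> 1"
    proof
      assume "ord x = 1"
      hence "x = \<one>\<^bsub>D\<^esub>" using xc ord_eq_1 by blast
      hence "a [^]\<^bsub>D\<^esub> i \<otimes>\<^bsub>D\<^esub> b = \<one>\<^bsub>D\<^esub>" using x by simp
      hence "inv\<^bsub>D\<^esub> (a [^]\<^bsub>D\<^esub> i) = b"
        using a b by (metis inv_equality inv_inv nat_pow_closed)
      hence "b = inv\<^bsub>D\<^esub> (a [^]\<^bsub>D\<^esub> i)" ..
      hence "ord b = ord (a [^]\<^bsub>D\<^esub> i)" using a by simp
      moreover have "ord (a [^]\<^bsub>D\<^esub> i) dvd p"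
        using a by (simp add: pow_eq_id[symmetric] nat_pow_pow) (simp add: pow_eq_id orda)
      ultimately have "2 dvd p" using ordb by simp
      thus False using p by simp
    qed
    ultimately show ?thesis
      by (metis prime_nat_iff two_is_prime_nat)
  qed
  have disj: "R \<inter> S = {}"
  proof (safe)
    fix x assume "x \<in> R" "x \<in> S"
    hence "2 dvd p" using R_pow[of x] S_ord[of x] R pow_eq_id by (metis subsetD)
    thus "x \<in> {}" using p by simp
  qed
  have "inj_on (\<lambda>x. x \<otimes>\<^bsub>D\<^esub> b) R"
    using R b by (meson inj_onI right_cancel subsetD)
  hence cardS: "card S = p" by (simp add: S_def card_image cardR)
  have finRS: "finite R" "finite S" by (auto simp: R_def S_def)
  \<comment> \<open>Rotations and reflections exhaust the group by cardinality.\<close>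
  have "card (R \<union> S) = 2 * p"
    using finRS disj cardR cardS by (simp add: card_Un_disjoint)
  hence carr: "carrier D = R \<union> S"
    using card R S fin by (metis card_subset_eq Un_least)
  have one: "\<one>\<^bsub>D\<^esub> \<in> R" using p0 by (auto simp: R_def intro!: image_eqI[of _ _ 0])
  have "{x \<in> carrier D. x [^]\<^bsub>D\<^esub> (2 :: nat) = \<one>\<^bsub>D\<^esub>} = insert \<one>\<^bsub>D\<^esub> S"
  proof -
    have "x = \<one>\<^bsub>D\<^esub>" if x: "x \<in> R" and "x [^]\<^bsub>D\<^esub> (2 :: nat) = \<one>\<^bsub>D\<^esub>" for x
    proof -
      have xc: "x \<in> carrier D" using R x by blast
      have "ord x dvd 2" "ord x dvd p" using that R_pow[OF x] xc by (simp_all add: pow_eq_id)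
      moreover have "coprime 2 p" using p by simp
      ultimately have "ord x = 1" by (metis coprime_common_divisor_nat)
      thus ?thesis using xc ord_eq_1 by blast
    qed
    moreover have "x [^]\<^bsub>D\<^esub> (2 :: nat) = \<one>\<^bsub>D\<^esub>" if "x \<in> S" for x
      using that S S_ord[OF that] pow_eq_id[of x 2] by auto
    ultimately show ?thesis using carr by auto
  qed
  moreover have "\<one>\<^bsub>D\<^esub> \<notin> S" using one disj by blast
  ultimately show "card {x \<in> carrier D. x [^]\<^bsub>D\<^esub> (2 :: nat) = \<one>\<^bsub>D\<^esub>} = p + 1"
    using finRS cardS by simp
  have "x [^]\<^bsub>D\<^esub> p \<noteq> \<one>\<^bsub>D\<^esub>" if "x \<in> S" for x
    using that S S_ord[OF that] p pow_eq_id[of x p] by auto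
  hence "{x \<in> carrier D. x [^]\<^bsub>D\<^esub> p = \<one>\<^bsub>D\<^esub>} = R"
    using carr R_pow by auto
  thus "card {x \<in> carrier D. x [^]\<^bsub>D\<^esub> p = \<one>\<^bsub>D\<^esub>} = p" using cardR by simp
  show "{x \<in> carrier D. x [^]\<^bsub>D\<^esub> (2 * p) = \<one>\<^bsub>D\<^esub>} = carrier D"
    using pow_order_eq_1 card by (auto simp: Coset.order_def)
qed

lemma odd_prime_gt_2: "prime p \<Longrightarrow> odd p \<Longrightarrow> p > 2" for p :: nat
  using prime_gt_1_nat[of p] by (cases "p = 2") auto

text \<open>The torsion counts of \<open>D\<close> are squared: \<open>(p + 1)^2\<close> elements
  have order dividing 2 and \<open>p^2\<close> have order dividing \<open>p\<close>. Removing the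
  identity leaves the elements of order exactly 2 and exactly \<open>p\<close>.\<close>

lemma DirProd_dihedral_orders:
  assumes p: "prime p" "odd p" and D: "is_dihedral p D"
  defines "G \<equiv> D \<times>\<times> D"
  shows "group G" and "card (carrier G) = 4 * p^2"
    and "\<And>z. z \<in> carrier G \<Longrightarrow> group.ord G z \<in> {1, 2, p, 2 * p}"
    and "card {z \<in> carrier G. group.ord G z = 1} = 1"
    and "card {z \<in> carrier G. group.ord G z = 2} = p^2 + 2 * p"
    and "card {z \<in> carrier G. group.ord G z = p} = p^2 - 1"
    and "card {z \<in> carrier G. group.ord G z = 2 * p} = 2 * p^2 - 2 * p"
proof -
  have "group D" and card: "card (carrier D) = 2 * p"
    using D by (auto simp: is_dihedral_def)
  then interpret group G unfolding G_def by (intro DirProd_group)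
  show "group G" by (rule is_group)
  show cardG: "card (carrier G) = 4 * p^2"
    by (simp add: G_def card card_cartesian_product power2_eq_square)
  note p2 = odd_prime_gt_2[OF p]
  have fin: "finite (carrier G)"
    using cardG p2 by (intro card_ge_0_finite) simp
  let ?N = "\<lambda>n. {z \<in> carrier G. ord z = n}"
  have tors: "{z \<in> carrier G. ord z dvd n} =
      {x \<in> carrier D. x [^]\<^bsub>D\<^esub> n = \<one>\<^bsub>D\<^esub>} \<times> {x \<in> carrier D. x [^]\<^bsub>D\<^esub> n = \<one>\<^bsub>D\<^esub>}" for n
    using DirProd_torsion[of D D n] pow_eq_id by (auto simp: G_def[symmetric])
  have dvd2p: "n dvd 2 * p \<longleftrightarrow> n \<in> {1, 2, p, 2 * p}" for n
  proof
    assume "n dvd 2 * p"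
    then obtain a b where ab: "n = a * b" "a dvd 2" "b dvd p"
      by (rule dvd_productE)
    hence "a \<in> {1, 2}" "b \<in> {1, p}" using p two_is_prime_nat by (auto simp: prime_nat_iff)
    thus "n \<in> {1, 2, p, 2 * p}" using ab by auto
  qed auto
  have "{z \<in> carrier G. ord z dvd 2 * p} = carrier G"
    unfolding tors dihedral_torsion(3)[OF p D] by (simp add: G_def)
  thus orders: "ord z \<in> {1, 2, p, 2 * p}" if "z \<in> carrier G" for z
    using that dvd2p by blast
  have "?N 1 = {\<one>\<^bsub>G\<^esub>}" using ord_eq_1 by auto
  thus N1: "card (?N 1) = 1" by simp
  have "n dvd 2 \<longleftrightarrow> n = 1 \<or> n = 2" for n :: nat
    using two_is_prime_nat by (auto simp: prime_nat_iff)
  hence "{z \<in> carrier G. ord z dvd 2} = ?N 1 \<union> ?N 2" by auto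
  moreover have "card {z \<in> carrier G. ord z dvd 2} = (p + 1) * (p + 1)"
    unfolding tors card_cartesian_product dihedral_torsion[OF p D] ..
  ultimately have "(p + 1) * (p + 1) = card (?N 1 \<union> ?N 2)" by simp
  also have "\<dots> = card (?N 1) + card (?N 2)"
    using fin by (intro card_Un_disjoint) auto
  finally show N2: "card (?N 2) = p^2 + 2 * p"
    using N1 by (simp add: power2_eq_square)
  have "n dvd p \<longleftrightarrow> n = 1 \<or> n = p" for n
    using p by (auto simp: prime_nat_iff)
  hence "{z \<in> carrier G. ord z dvd p} = ?N 1 \<union> ?N p" by auto
  moreover have "card {z \<in> carrier G. ord z dvd p} = p * p"
    unfolding tors card_cartesian_product dihedral_torsion[OF p D] ..
  ultimately have "p * p = card (?N 1 \<union> ?N p)" by simp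
  also have "\<dots> = card (?N 1) + card (?N p)"
    using fin p2 by (intro card_Un_disjoint) auto
  finally show Np: "card (?N p) = p^2 - 1"
    using N1 by (simp add: power2_eq_square)
  \<comment> \<open>Order \<open>2 * p\<close> is all that remains, so its count is obtained by
    subtracting the other three from \<open>4 * p^2\<close>.\<close>
  have "carrier G = ?N 1 \<union> ?N 2 \<union> ?N p \<union> ?N (2 * p)"
    using orders by auto
  hence "4 * p^2 = card (?N 1 \<union> ?N 2 \<union> ?N p \<union> ?N (2 * p))"
    using cardG by simp
  also have "\<dots> = card (?N 1) + card (?N 2) + card (?N p) + card (?N (2 * p))"
    using fin p2 by (subst card_Un_disjoint, force, force, force)+ simp
  finally show "card (?N (2 * p)) = 2 * p^2 - 2 * p"
    using N1 N2 Np p2 by simp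
qed

section \<open>Vertex degrees, and \<open>M\<close> as a quotient matrix\<close>

text \<open>The added 1 is \<open>x\<close> itself, which lies in the set on the right by
  reflexivity of divisibility but is not its own neighbour.\<close>

lemma out_degree_superpower_graph:
  assumes "finite (carrier G)" and x: "x \<in> carrier G"
  shows "out_degree (with_proj (superpower_graph G)) x + 1 =
    card {y \<in> carrier G. group.ord G x dvd group.ord G y \<or> group.ord G y dvd group.ord G x}"
    (is "_ = card ?Y")
proof -
  have "out_arcs (with_proj (superpower_graph G)) x = Pair x ` (?Y - {x})"
    using x by (auto simp: out_arcs_def superpower_graph_def)
  hence "out_degree (with_proj (superpower_graph G)) x = card (?Y - {x})"
    by (simp add: out_degree_def card_image inj_on_def)
  moreover have "x \<in> ?Y" "finite ?Y" using assms by auto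
  ultimately show ?thesis
    using card_Suc_Diff1[of ?Y x] by simp
qed

lemma M_matrix_carrier: "M_matrix n \<alpha> \<in> carrier_mat 4 4"
  by (intro carrier_matI) (simp_all add: M_matrix_def Let_def mat_of_rows_list_def)

text \<open>Passing from \<open>M - \<lambda> I\<close> to \<open>\<lambda> I - M\<close> multiplies
  the determinant by \<open>(-1)^4 = 1\<close>.\<close>

lemma M_det_poly_eq_char_poly:
  "M_det_poly n \<alpha> = char_poly (map_mat complex_of_real (M_matrix n \<alpha>))"
proof -
  let ?M = "map_mat complex_of_real (M_matrix n \<alpha>)"
  note M = M_matrix_carrier[of n \<alpha>]
  have "map_mat (\<lambda>x. [:complex_of_real x:]) (M_matrix n \<alpha>) - [:0, 1:] \<cdot>\<^sub>m 1\<^sub>m 4 =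
      (-1) \<cdot>\<^sub>m char_poly_matrix ?M"
    by (rule eq_matI) (use M in \<open>auto simp: char_poly_matrix_def\<close>)
  moreover have "dim_col (char_poly_matrix ?M) = 4"
    using M by (simp add: char_poly_matrix_def)
  ultimately show ?thesis
    by (simp add: M_det_poly_def char_poly_def)
qed

text \<open>The class index follows the row order of the matrix \<open>M\<close>: orders 1, 2, \<open>2p\<close>, \<open>p\<close>.\<close>

definition order_class :: "nat \<Rightarrow> nat \<Rightarrow> nat" where
  "order_class p r = (if r = 1 then 0 else if r = 2 then 1 else if r = p then 3 else 2)"

text \<open>This is \<open>\<alpha>\<close> times the vertex degree minus
  \<open>1 - \<alpha>\<close>. The subtraction offsets the weight \<open>1 - \<alpha>\<close> that
  \<open>class_weight\<close> places on the diagonal, where the adjacency matrix is zero.\<close>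

definition class_diag :: "nat \<Rightarrow> real \<Rightarrow> nat \<Rightarrow> real" where
  "class_diag p \<alpha> k =
     (if k = 1 then (3 * real p^2 + 1) * \<alpha> - 1
      else if k = 3 then (3 * real p^2 - 2 * real p) * \<alpha> - 1
      else 4 * real p^2 * \<alpha> - 1)"

text \<open>The exceptional pair consists of the classes of orders 2 and \<open>p\<close>, the only
  two between which there are no edges.\<close>

definition class_weight :: "real \<Rightarrow> nat \<Rightarrow> nat \<Rightarrow> real" where
  "class_weight \<alpha> k l = (if {k, l} = {1, 3} then 0 else 1 - \<alpha>)"

definition class_size :: "nat \<Rightarrow> nat \<Rightarrow> nat" where
  "class_size p k =
     (if k = 0 then 1 else if k = 1 then p^2 + 2 * p
      else if k = 2 then 2 * p^2 - 2 * p else p^2 - 1)"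

text \<open>This identifies \<open>M\<close> with the matrix \<open>Q\<close> of
  \<open>char_poly_blockwise_constant\<close>. Positivity of \<open>p\<close> makes the natural
  number subtractions in \<open>class_size\<close> agree with the real ones.\<close>

lemma M_matrix_eq:
  assumes "p > 0"
  shows "M_matrix p \<alpha> = mat 4 4 (\<lambda>(k, l).
    (if k = l then class_diag p \<alpha> k else 0) + class_weight \<alpha> k l * real (class_size p l))"
proof (rule eq_matI)
  fix k l assume "k < dim_row (mat 4 4 (\<lambda>(k, l).
      (if k = l then class_diag p \<alpha> k else 0) + class_weight \<alpha> k l * real (class_size p l)))"
    "l < dim_col (mat 4 4 (\<lambda>(k, l).
      (if k = l then class_diag p \<alpha> k else 0) + class_weight \<alpha> k l * real (class_size p l)))"
  hence kl: "k \<in> {0, 1, 2, 3}" "l \<in> {0, 1, 2, 3}" by auto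
  have "1 \<le> p^2" "2 * p \<le> 2 * p^2" using assms by (auto simp: power2_eq_square)
  hence sizes: "real (class_size p 2) = 2 * real p^2 - 2 * real p" "real (class_size p 3) = real p^2 - 1"
    "real (class_size p (Suc 0)) = real p^2 + 2 * real p" "real (class_size p 0) = 1"
    by (simp_all add: class_size_def of_nat_diff)
  from kl show "M_matrix p \<alpha> $$ (k, l) = mat 4 4 (\<lambda>(k, l).
      (if k = l then class_diag p \<alpha> k else 0) + class_weight \<alpha> k l * real (class_size p l)) $$ (k, l)"
    by (elim insertE emptyE;
        simp add: M_matrix_def Let_def mat_of_rows_list_def class_diag_def class_weight_def
          doubleton_eq_iff sizes; simp add: algebra_simps)
qed (simp_all add: M_matrix_def Let_def mat_of_rows_list_def)

text \<open>Among the divisors of \<open>2 * p\<close>, only 2 and \<open>p\<close> are incomparable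
  under divisibility.\<close>

lemma dvd_iff_order_class:
  assumes p: "p > 2" "odd p" and "r \<in> {1, 2, p, 2 * p}" "s \<in> {1, 2, p, 2 * p}"
  shows "r dvd s \<or> s dvd r \<longleftrightarrow> {order_class p r, order_class p s} \<noteq> {1, 3}"
proof -
  have "\<not> p dvd 2" using p by (auto dest: dvd_imp_le)
  with assms show ?thesis
    by (auto simp: order_class_def doubleton_eq_iff)
qed

lemma card_nth_distinct:
  "distinct xs \<Longrightarrow> card {i. i < length xs \<and> P (xs ! i)} = card {x \<in> set xs. P x}"
  by (metis length_filter_conv_card distinct_filter distinct_card set_filter)

section \<open>The spectrum for the square of a dihedral group\<close>

context
  fixes p :: nat and D :: "('a, 'b) monoid_scheme"
  assumes p: "prime p" "odd p" and D: "is_dihedral p D"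
begin

interpretation G: group "D \<times>\<times> D"
  by (rule DirProd_dihedral_orders(1)[OF p D])

lemmas p_gt_2 = odd_prime_gt_2[OF p]

lemma finite_carrier_DirProd: "finite (carrier (D \<times>\<times> D))"
  using DirProd_dihedral_orders(2)[OF p D] p_gt_2 by (intro card_ge_0_finite) simp

text \<open>Index 2 is the catch-all of \<open>order_class\<close>; it means order
  \<open>2 * p\<close> because no further orders occur in the carrier.\<close>

lemma order_class_eq_iff:
  assumes "z \<in> carrier (D \<times>\<times> D)"
  shows "order_class p (G.ord z) = 0 \<longleftrightarrow> G.ord z = 1"
    and "order_class p (G.ord z) = 1 \<longleftrightarrow> G.ord z = 2"
    and "order_class p (G.ord z) = 2 \<longleftrightarrow> G.ord z = 2 * p"
    and "order_class p (G.ord z) = 3 \<longleftrightarrow> G.ord z = p"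
  using DirProd_dihedral_orders(3)[OF p D assms] p_gt_2 by (auto simp: order_class_def)

lemma card_order_class:
  assumes "k < 4"
  shows "card {z \<in> carrier (D \<times>\<times> D). order_class p (G.ord z) = k} = class_size p k"
proof -
  let ?G = "D \<times>\<times> D"
  have eqs: "{z \<in> carrier ?G. order_class p (G.ord z) = 0} = {z \<in> carrier ?G. G.ord z = 1}"
      "{z \<in> carrier ?G. order_class p (G.ord z) = 1} = {z \<in> carrier ?G. G.ord z = 2}"
      "{z \<in> carrier ?G. order_class p (G.ord z) = 2} = {z \<in> carrier ?G. G.ord z = 2 * p}"
      "{z \<in> carrier ?G. order_class p (G.ord z) = 3} = {z \<in> carrier ?G. G.ord z = p}"
    using order_class_eq_iff by blast+
  have "k \<in> {0, 1, 2, 3}" using assms by auto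
  thus ?thesis
    by (elim insertE emptyE; simp only: eqs DirProd_dihedral_orders(4-7)[OF p D];
        simp add: class_size_def)
qed

lemma out_degree_DirProd_dihedral:
  assumes z: "z \<in> carrier (D \<times>\<times> D)"
  shows "\<alpha> * real (out_degree (with_proj (superpower_graph (D \<times>\<times> D))) z) =
    class_diag p \<alpha> (order_class p (G.ord z)) + (1 - \<alpha>)"
proof -
  let ?G = "D \<times>\<times> D" and ?k = "order_class p (G.ord z)"
  let ?C = "\<lambda>k. {y \<in> carrier ?G. order_class p (G.ord y) = k}"
  let ?d = "out_degree (with_proj (superpower_graph ?G)) z"
  have k4: "?k \<in> {0, 1, 2, 3}" by (simp add: order_class_def)
  \<comment> \<open>\<open>l\<close> is the class whose members are not adjacent to
    \<open>z\<close>. The value 4 indexes no class, so \<open>?C 4\<close> is empty and covers the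
    case where \<open>z\<close> is adjacent to every other vertex.\<close>
  define l :: nat where "l = (if ?k = 1 then 3 else if ?k = 3 then 1 else 4)"
  have cardl: "card (?C l) = (if l = 4 then 0 else class_size p l)"
  proof (cases "l = 4")
    case True
    have "?C 4 = {}" by (auto simp: order_class_def)
    hence "card (?C 4) = 0" by (simp only: card.empty)
    with True show ?thesis by simp
  next
    case False
    hence "l < 4" by (auto simp: l_def split: if_splits)
    from card_order_class[OF this] False show ?thesis by simp
  qed
  have adj: "G.ord z dvd G.ord y \<or> G.ord y dvd G.ord z \<longleftrightarrow> order_class p (G.ord y) \<noteq> l"
    if y: "y \<in> carrier ?G" for y
  proof -
    have "order_class p (G.ord y) \<noteq> 4" by (simp add: order_class_def)
    thus ?thesis
      using k4 unfolding l_def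
      by (subst dvd_iff_order_class[OF p_gt_2 p(2) DirProd_dihedral_orders(3)[OF p D z]
            DirProd_dihedral_orders(3)[OF p D y]])
         (auto simp: doubleton_eq_iff)
  qed
  have "?d + 1 = card (carrier ?G - ?C l)"
    unfolding out_degree_superpower_graph[OF finite_carrier_DirProd z]
    by (rule arg_cong[of _ _ card]) (use adj in auto)
  also have "\<dots> = 4 * p^2 - card (?C l)"
    using finite_carrier_DirProd DirProd_dihedral_orders(2)[OF p D]
    by (subst card_Diff_subset) auto
  finally have d: "?d = 4 * p^2 - card (?C l) - 1" by simp
  \<comment> \<open>These bounds keep the truncated subtractions exact when cast to the
    reals.\<close>
  have "1 \<le> p^2" "2 * p \<le> p^2" using p_gt_2 by (auto simp: power2_eq_square)
  hence "real ?d = (if ?k = 1 then 3 * real p^2 else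
      if ?k = 3 then 3 * real p^2 - 2 * real p - 1 else 4 * real p^2 - 1)"
    unfolding d cardl unfolding l_def class_size_def by (auto simp: of_nat_diff)
  thus ?thesis
    by (simp add: class_diag_def algebra_simps)
qed

text \<open>This is the shape required by \<open>char_poly_blockwise_constant\<close>. Distinctness
  of \<open>vs\<close> ensures that different indices give different vertices, so the off-diagonal
  entries depend on the classes alone.\<close>

lemma A_alpha_matrix_DirProd_dihedral:
  assumes vs: "distinct vs" "set vs = carrier (D \<times>\<times> D)"
  shows "A_alpha_matrix \<alpha> (superpower_graph (D \<times>\<times> D)) vs =
    mat (length vs) (length vs) (\<lambda>(i, j).
      (if i = j then class_diag p \<alpha> (order_class p (G.ord (vs ! i))) else 0) +
      class_weight \<alpha> (order_class p (G.ord (vs ! i))) (order_class p (G.ord (vs ! j))))"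
    (is "_ = mat ?n ?n ?f")
proof (rule eq_matI)
  fix i j assume "i < dim_row (mat ?n ?n ?f)" "j < dim_col (mat ?n ?n ?f)"
  hence ij: "i < ?n" "j < ?n" by auto
  have in_G: "vs ! i \<in> carrier (D \<times>\<times> D)" "vs ! j \<in> carrier (D \<times>\<times> D)"
    using ij vs nth_mem by blast+
  note adj = dvd_iff_order_class[OF p_gt_2 p(2) in_G[THEN DirProd_dihedral_orders(3)[OF p D]]]
  show "A_alpha_matrix \<alpha> (superpower_graph (D \<times>\<times> D)) vs $$ (i, j) = mat ?n ?n ?f $$ (i, j)"
  proof (cases "i = j")
    case True
    thus ?thesis
      using ij out_degree_DirProd_dihedral[OF in_G(1)]
      by (simp add: A_alpha_matrix_def degree_matrix_def adjacency_matrix_def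
          superpower_graph_def class_weight_def doubleton_eq_iff)
  next
    case False
    hence "vs ! i \<noteq> vs ! j" using ij vs nth_eq_iff_index_eq by blast
    with False ij in_G adj show ?thesis
      by (simp add: A_alpha_matrix_def degree_matrix_def adjacency_matrix_def
          superpower_graph_def class_weight_def)
  qed
qed (simp_all add: A_alpha_matrix_def degree_matrix_def adjacency_matrix_def)

lemma eigenvalue_mset_DirProd_dihedral:
  fixes \<alpha> :: real
  assumes vs: "distinct vs" "set vs = carrier (D \<times>\<times> D)"
  defines "d \<equiv> \<lambda>k. complex_of_real (class_diag p \<alpha> k)"
  shows "eigenvalue_mset (A_alpha_matrix \<alpha> (superpower_graph (D \<times>\<times> D)) vs) =
    (\<Sum>k<4. replicate_mset (class_size p k - 1) (d k)) + proots (M_det_poly p \<alpha>)"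
proof -
  let ?n = "length vs" and ?A = "A_alpha_matrix \<alpha> (superpower_graph (D \<times>\<times> D)) vs"
  define c where "c = (\<lambda>i. order_class p (G.ord (vs ! i)))"
  let ?w = "\<lambda>k l. complex_of_real (class_weight \<alpha> k l)"
  have A: "map_mat complex_of_real ?A =
      mat ?n ?n (\<lambda>(i, j). (if i = j then d (c i) else 0) + ?w (c i) (c j))"
    unfolding A_alpha_matrix_DirProd_dihedral[OF vs] c_def d_def by (rule eq_matI) auto
  have s: "card {i. i < ?n \<and> c i = k} = class_size p k" if "k < 4" for k
    using card_nth_distinct[OF vs(1), of "\<lambda>z. order_class p (G.ord z) = k"]
      card_order_class[OF that] by (simp add: c_def vs(2))
  have Q: "map_mat complex_of_real (M_matrix p \<alpha>) =
      mat 4 4 (\<lambda>(k, l). (if k = l then d k else 0) + ?w k l * of_nat (card {i. i < ?n \<and> c i = l}))"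
    using p_gt_2 by (subst M_matrix_eq) (auto intro!: eq_matI simp: d_def s)
  have c4: "c i < 4" for i by (simp add: c_def order_class_def)
  have "char_poly (map_mat complex_of_real ?A) * (\<Prod>k<4. [:- d k, 1:]) =
      char_poly (map_mat complex_of_real (M_matrix p \<alpha>)) *
      (\<Prod>k<4. [:- d k, 1:] ^ card {i. i < ?n \<and> c i = k})"
    unfolding A Q by (rule char_poly_blockwise_constant[OF c4])
  \<comment> \<open>Every class is nonempty, so one linear factor per class can be split off to
    match the extra product on the left.\<close>
  also have "(\<Prod>k<4. [:- d k, 1:] ^ card {i. i < ?n \<and> c i = k}) =
      (\<Prod>k<4. [:- d k, 1:] * [:- d k, 1:] ^ (class_size p k - 1))"
  proof (rule prod.cong)
    fix k :: nat assume "k \<in> {..<4}"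
    moreover have "1 < p * p" using p_gt_2 by (intro less_1_mult) auto
    hence "class_size p k > 0"
      using p_gt_2 by (auto simp: class_size_def power2_eq_square)
    ultimately show "[:- d k, 1:] ^ card {i. i < ?n \<and> c i = k} =
        [:- d k, 1:] * [:- d k, 1:] ^ (class_size p k - 1)"
      using s[of k] power_eq_if[of "[:- d k, 1:]" "class_size p k"] by simp
  qed simp
  finally have "char_poly (map_mat complex_of_real ?A) * (\<Prod>k<4. [:- d k, 1:]) =
      char_poly (map_mat complex_of_real (M_matrix p \<alpha>)) *
      (\<Prod>k<4. [:- d k, 1:] ^ (class_size p k - 1)) * (\<Prod>k<4. [:- d k, 1:])"
    by (simp only: prod.distrib mult_ac)
  \<comment> \<open>The shared product of linear factors is a nonzero polynomial and
    cancels.\<close>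
  hence "char_poly (map_mat complex_of_real ?A) =
      char_poly (map_mat complex_of_real (M_matrix p \<alpha>)) *
      (\<Prod>k<4. [:- d k, 1:] ^ (class_size p k - 1))"
    by (rule iffD1[OF mult_right_cancel, rotated]) simp
  also have "proots \<dots> = proots (char_poly (map_mat complex_of_real (M_matrix p \<alpha>))) +
      (\<Sum>k<4. replicate_mset (class_size p k - 1) (d k))"
  proof (subst proots_mult)
    show "char_poly (map_mat complex_of_real (M_matrix p \<alpha>)) \<noteq> 0"
      using degree_monic_char_poly[of "map_mat complex_of_real (M_matrix p \<alpha>)" 4] M_matrix_carrier
      by force
    show "proots (char_poly (map_mat complex_of_real (M_matrix p \<alpha>))) +
        proots (\<Prod>k<4. [:- d k, 1:] ^ (class_size p k - 1)) =
        proots (char_poly (map_mat complex_of_real (M_matrix p \<alpha>))) +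
        (\<Sum>k<4. replicate_mset (class_size p k - 1) (d k))"
      by (subst proots_prod) (simp_all add: proots_power repeat_mset_replicate_mset)
  qed (simp add: prod_zero_iff)
  finally show ?thesis
    by (simp add: eigenvalue_mset_def M_det_poly_eq_char_poly)
qed

end

theorem theorem3p1:
  fixes p :: nat and \<alpha> :: real
    and D :: "('a, 'b) monoid_scheme"
    and vs :: "('a \<times> 'a) list"
  assumes "prime p" and "odd p"
    and "0 \<le> \<alpha>" and "\<alpha> \<le> 1"
    and "is_dihedral p D"
    and "distinct vs" and "set vs = pverts (superpower_graph (D \<times>\<times> D))"
  shows "card (carrier (D \<times>\<times> D)) = 4 * p^2 \<and>
    size (eigenvalue_mset (A_alpha_matrix \<alpha> (superpower_graph (D \<times>\<times> D)) vs)) = 4 * p^2 \<and>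
    size (proots (M_det_poly p \<alpha>)) = 4 \<and>
    eigenvalue_mset (A_alpha_matrix \<alpha> (superpower_graph (D \<times>\<times> D)) vs) =
      replicate_mset (p^2 - 2) (complex_of_real ((3 * real p^2 - 2 * real p) * \<alpha> - 1)) +
      replicate_mset (2 * p^2 - 2 * p - 1) (complex_of_real (4 * real p^2 * \<alpha> - 1)) +
      replicate_mset (p^2 + 2 * p - 1) (complex_of_real ((3 * real p^2 + 1) * \<alpha> - 1)) +
      proots (M_det_poly p \<alpha>)"
proof (intro conjI)
  have vs: "set vs = carrier (D \<times>\<times> D)"
    using assms(7) by (simp add: superpower_graph_def)
  show card: "card (carrier (D \<times>\<times> D)) = 4 * p^2"
    by (rule DirProd_dihedral_orders(2)) fact+
  have len: "length vs = 4 * p^2"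
    using card vs distinct_card[OF assms(6)] by simp
  show "size (eigenvalue_mset (A_alpha_matrix \<alpha> (superpower_graph (D \<times>\<times> D)) vs)) = 4 * p^2"
    by (rule size_eigenvalue_mset)
       (simp add: A_alpha_matrix_def degree_matrix_def adjacency_matrix_def len)
  show "size (proots (M_det_poly p \<alpha>)) = 4"
    using size_eigenvalue_mset[OF M_matrix_carrier] by (simp add: M_det_poly_eq_char_poly eigenvalue_mset_def)
  have lessThan4: "{..<4} = {0, 1, 2, 3 :: nat}" by auto
  show "eigenvalue_mset (A_alpha_matrix \<alpha> (superpower_graph (D \<times>\<times> D)) vs) =
      replicate_mset (p^2 - 2) (complex_of_real ((3 * real p^2 - 2 * real p) * \<alpha> - 1)) +
      replicate_mset (2 * p^2 - 2 * p - 1) (complex_of_real (4 * real p^2 * \<alpha> - 1)) +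
      replicate_mset (p^2 + 2 * p - 1) (complex_of_real ((3 * real p^2 + 1) * \<alpha> - 1)) +
      proots (M_det_poly p \<alpha>)"
    \<comment> \<open>Class 0 is the identity alone and yields \<open>1 - 1 = 0\<close> copies; the
      other three classes yield the listed families, with \<open>p^2 - 1 - 1\<close> becoming
      \<open>p^2 - 2\<close>.\<close>
    unfolding eigenvalue_mset_DirProd_dihedral[OF assms(1,2,5,6) vs] lessThan4
    by (simp add: class_size_def class_diag_def add_ac numeral_2_eq_2)
qed

end
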